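(* Let $N$ be a positive integer and $X$ a word set all of whose words have length at least $N$. Then $X$ is the maximal $N$-preimage of its $N$-block presentation $X^{[N]}$ if and only if every letter $a\in\mathcal{L}_1(X)$ is $N$-connected with regard to $X$.
   Context: Words over a finite alphabet may be finite (indexed from $0$), infinite or bi-infinite; a word set is any set of such words. For a word $w$, $w_{[i,j]}=w_i\dots w_j$. $\mathcal{L}_n(X)$ is the set of subwords (factors) of length $n$ of words of $X$. A projection is a map between alphabets extended letter by letter to words; $X\succcurlyeq Y$ means $\varphi(X)=Y$ for some projection $\varphi$; $X\sim Y$ (similar) means $X\succcurlyeq Y$ and $Y\succcurlyeq X$. The $N$-block presentation $X^{[N]}$ is obtained by replacing each word $u$ by the word whose $i$-th letter is the block $[u_{[i,i+N-1]}]$ (for all $i$ such that $i+N-1$ is a position of $u$). An $N$-preimage of a word set $Z$ is any word set $Y$ with $Y^{[N]}\sim Z$. The maximal $N$-preimage of $Z$ (when $Z$ is similar to some $N$-block presentation) is an $N$-preimage $W$ of $Z$ such that $W\succcurlyeq Y$ for every $N$-preimage $Y$ of $Z$; it exists and is unique up to similarity. For a letter $a$ and $N\ge1$, the graph $G_X(a,N)$ is the undirected graph whose vertices are the pairs $(i,u)$ with $0\le i<N$, $u\in\mathcal{L}_N(X)$, $u_i=a$, and whose edges are the pairs $\{(i,w_{[0,N-1]}),(i-1,w_{[1,N]})\}$ with $0<i<N$, $w\in\mathcal{L}_{N+1}(X)$, $w_i=a$. A letter $a$ is $N$-connected with regard to $X$ if $G_X(a,N)$ is connected. *)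

theory Defs
  imports "HOL-Library.Extended_Nat"
begin

datatype (letters: 'a) word =
    FinWord "'a list"
  | InfWord "nat \<Rightarrow> 'a"
  | BiinfWord "int \<Rightarrow> 'a"

primrec positions :: "'a word \<Rightarrow> int set" where
  "positions (FinWord xs) = {0..<int (length xs)}"
| "positions (InfWord f) = {0..}"
| "positions (BiinfWord f) = UNIV"

primrec word_length :: "'a word \<Rightarrow> enat" where
  "word_length (FinWord xs) = enat (length xs)"
| "word_length (InfWord f) = \<infinity>"
| "word_length (BiinfWord f) = \<infinity>"

primrec letter_at :: "'a word \<Rightarrow> int \<Rightarrow> 'a" where
  "letter_at (FinWord xs) i = xs ! nat i"
| "letter_at (InfWord f) i = f (nat i)"
| "letter_at (BiinfWord f) i = f i"

text \<open>The finite word \<open>u_i \<dots> u_j\<close>; meaningful only if all of \<open>i, \<dots>, j\<close> are positions of \<open>u\<close>.\<close>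

definition subword :: "'a word \<Rightarrow> int \<Rightarrow> int \<Rightarrow> 'a list" where
  "subword u i j = map (letter_at u) [i..j]"

text \<open>All words of a word set are over one common finite alphabet.\<close>

definition word_set :: "'a word set \<Rightarrow> bool" where
  "word_set X \<longleftrightarrow> finite (\<Union>u\<in>X. letters u)"

definition factors :: "nat \<Rightarrow> 'a word set \<Rightarrow> 'a list set" where
  "factors n X =
    {subword u i (i + int n - 1) | u i. u \<in> X \<and> {i..i + int n - 1} \<subseteq> positions u}"

definition projects_onto :: "'a word set \<Rightarrow> 'b word set \<Rightarrow> bool" (infix \<open>\<succcurlyeq>\<close> 50) where
  "X \<succcurlyeq> Y \<longleftrightarrow> (\<exists>\<phi>. map_word \<phi> ` X = Y)"

definition similar :: "'a word set \<Rightarrow> 'b word set \<Rightarrow> bool" where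
  "similar X Y \<longleftrightarrow> X \<succcurlyeq> Y \<and> Y \<succcurlyeq> X"

text \<open>For \<open>N \<ge> 1\<close>, a finite word of length \<open>l\<close> has \<open>l + 1 - N\<close> blocks of length \<open>N\<close>
  (none if \<open>l < N\<close>, by truncated subtraction).\<close>

primrec block_word :: "nat \<Rightarrow> 'a word \<Rightarrow> 'a list word" where
  "block_word N (FinWord xs) =
    FinWord (map (\<lambda>i. subword (FinWord xs) (int i) (int i + int N - 1))
      [0..<length xs + 1 - N])"
| "block_word N (InfWord f) =
    InfWord (\<lambda>i. subword (InfWord f) (int i) (int i + int N - 1))"
| "block_word N (BiinfWord f) =
    BiinfWord (\<lambda>i. subword (BiinfWord f) i (i + int N - 1))"

definition block_presentation :: "nat \<Rightarrow> 'a word set \<Rightarrow> 'a list word set" where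
  "block_presentation N X = block_word N ` X"

definition preimage :: "nat \<Rightarrow> 'a word set \<Rightarrow> 'b word set \<Rightarrow> bool" where
  "preimage N Y Z \<longleftrightarrow> word_set Y \<and> similar (block_presentation N Y) Z"

text \<open>The competing preimages range over word sets with letters in \<open>nat\<close>, since HOL cannot
  quantify over types inside a formula. As alphabets are finite, this loses nothing: see
  \<open>maximal_preimage_any_alphabet\<close> below.\<close>

definition maximal_preimage :: "nat \<Rightarrow> 'a word set \<Rightarrow> 'b word set \<Rightarrow> bool" where
  "maximal_preimage N W Z \<longleftrightarrow>
    preimage N W Z \<and> (\<forall>Y :: nat word set. preimage N Y Z \<longrightarrow> W \<succcurlyeq> Y)"

definition graph_vertices :: "'a word set \<Rightarrow> 'a \<Rightarrow> nat \<Rightarrow> (nat \<times> 'a list) set" where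
  "graph_vertices X a N = {(i, u). i < N \<and> u \<in> factors N X \<and> u ! i = a}"

definition graph_edges :: "'a word set \<Rightarrow> 'a \<Rightarrow> nat \<Rightarrow> (nat \<times> 'a list) set set" where
  "graph_edges X a N =
    {{(i, take N w), (i - 1, tl w)} | i w.
      0 < i \<and> i < N \<and> w \<in> factors (N + 1) X \<and> w ! i = a}"

definition graph_connected :: "'v set \<Rightarrow> 'v set set \<Rightarrow> bool" where
  "graph_connected V E \<longleftrightarrow> (\<forall>x\<in>V. \<forall>y\<in>V. (x, y) \<in> {(p, q). {p, q} \<in> E}\<^sup>*)"

definition connected_letter :: "nat \<Rightarrow> 'a word set \<Rightarrow> 'a \<Rightarrow> bool" where
  "connected_letter N X a \<longleftrightarrow> graph_connected (graph_vertices X a N) (graph_edges X a N)"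

lemma projects_onto_trans:
  assumes "X \<succcurlyeq> Y" "Y \<succcurlyeq> Z"
  shows "X \<succcurlyeq> Z"
proof -
  obtain f g where "map_word f ` X = Y" "map_word g ` Y = Z"
    using assms unfolding projects_onto_def by blast
  then have "map_word (g \<circ> f) ` X = Z"
    by (auto simp: image_image word.map_comp)
  then show ?thesis unfolding projects_onto_def by blast
qed

lemma block_word_map_word:
  assumes "N \<ge> 1"
  shows "block_word N (map_word f u) = map_word (map f) (block_word N u)"
  by (cases u) (use assms in \<open>auto simp: subword_def nat_less_iff\<close>)

lemma block_presentation_map_word:
  assumes "N \<ge> 1"
  shows "block_presentation N (map_word f ` X) = map_word (map f) ` block_presentation N X"
  using assms by (simp add: block_presentation_def image_image block_word_map_word)

lemma maximal_preimage_any_alphabet: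
  fixes Y :: "'c word set"
  assumes N: "N \<ge> 1" and max: "maximal_preimage N W Z" and pre: "preimage N Y Z"
  shows "W \<succcurlyeq> Y"
proof -
  let ?A = "\<Union>u\<in>Y. letters u"
  have "finite ?A"
    using pre by (simp add: preimage_def word_set_def)
  then obtain f :: "'c \<Rightarrow> nat" where f: "inj_on f ?A"
    using finite_imp_inj_to_nat_seg by metis
  define g where "g = inv_into ?A f"
  define Y' where "Y' = map_word f ` Y"
  have "map_word g (map_word f u) = u" if "u \<in> Y" for u
  proof -
    have "map_word (g \<circ> f) u = map_word id u"
      by (rule word.map_cong0) (use that f in \<open>auto simp: g_def intro!: inv_into_f_f\<close>)
    then show ?thesis by (simp add: word.map_comp word.map_id)
  qed
  then have inverse: "map_word g ` Y' = Y"
    by (force simp: Y'_def image_image)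
  have "similar (block_presentation N Y') (block_presentation N Y)"
    unfolding similar_def projects_onto_def
    using block_presentation_map_word[OF N, of f Y] block_presentation_map_word[OF N, of g Y']
    by (metis Y'_def inverse)
  then have "similar (block_presentation N Y') Z"
    using pre unfolding preimage_def similar_def by (meson projects_onto_trans)
  moreover have "word_set Y'"
    using \<open>finite ?A\<close> by (simp add: word_set_def Y'_def word.set_map flip: image_UN)
  ultimately have "W \<succcurlyeq> Y'"
    using max by (simp add: maximal_preimage_def preimage_def)
  moreover have "Y' \<succcurlyeq> Y"
    using inverse by (auto simp: projects_onto_def)
  ultimately show ?thesis by (rule projects_onto_trans)
qed

end

theory Submission
  imports Defs
begin

text \<open>A projection \<open>\<psi>\<close> of \<open>X\<^bsup>[N]\<^esup>\<close> onto \<open>Y\<^bsup>[N]\<^esup>\<close> assigns to each vertex \<open>(i, u)\<close> of \<open>G_X(a, N)\<close>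
  the letter \<open>\<psi>(u)_i\<close>, and this assignment is constant along edges because adjacent vertices
  describe the same position of a word of \<open>X\<close>. If all graphs are connected, it therefore descends
  to a projection of \<open>X\<close> onto \<open>Y\<close>. Conversely, decorating each letter occurrence in \<open>X\<close> with the
  connected component it belongs to yields an \<open>N\<close>-preimage \<open>Y\<close> that projects onto \<open>X\<close>;
  if also \<open>X\<close> projects onto \<open>Y\<close>, the two finite alphabets have equally many letters, so every graph
  has a single component.\<close>

section \<open>Words as labelled position sets\<close>

text \<open>Forgetting the letters leaves the kind of a word and its length; since the result is a
  word over \<open>unit\<close>, words over different alphabets can be compared.\<close>

abbreviation shape :: "'a word \<Rightarrow> unit word" where
  "shape \<equiv> map_word (\<lambda>_. ())"

primrec relabel :: "(int \<Rightarrow> 'b) \<Rightarrow> 'a word \<Rightarrow> 'b word" where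
  "relabel f (FinWord xs) = FinWord (map (\<lambda>i. f (int i)) [0..<length xs])"
| "relabel f (InfWord g) = InfWord (\<lambda>i. f (int i))"
| "relabel f (BiinfWord g) = BiinfWord f"

lemma shape_relabel [simp]: "shape (relabel f u) = shape u"
  by (cases u) (auto intro!: nth_equalityI)

lemma letter_at_relabel [simp]: "j \<in> positions u \<Longrightarrow> letter_at (relabel f u) j = f j"
  by (cases u) (auto simp: nat_less_iff)

lemma shape_map_word [simp]: "shape (map_word f u) = shape u"
  by (simp add: word.map_comp comp_def)

lemma positions_map_word [simp]: "positions (map_word f u) = positions u"
  by (cases u) auto

lemma letter_at_map_word [simp]:
  "j \<in> positions u \<Longrightarrow> letter_at (map_word f u) j = f (letter_at u j)"
  by (cases u) (auto simp: nat_less_iff)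

lemma positions_cong_shape: "shape u = shape v \<Longrightarrow> positions u = positions v"
  by (metis positions_map_word)

text \<open>Extensionality for all three kinds of words at once, so that later equalities of words
  are proved position by position without splitting on the kind.\<close>

lemma word_eqI:
  assumes "shape u = shape v" "\<And>j. j \<in> positions u \<Longrightarrow> letter_at u j = letter_at v j"
  shows "u = v"
proof (cases u)
  case (FinWord xs)
  with assms(1) obtain ys where v: "v = FinWord ys" by (cases v) auto
  then have "length xs = length ys"
    using assms(1) FinWord by (auto dest: map_eq_imp_length_eq)
  moreover have "xs ! i = ys ! i" if "i < length xs" for i
    using assms(2)[of "int i"] FinWord v that by simp
  ultimately show ?thesis using FinWord v by (simp add: nth_equalityI)
next
  case (InfWord f)
  with assms(1) obtain g where v: "v = InfWord g" by (cases v) auto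
  have "f i = g i" for i
    using assms(2)[of "int i"] InfWord v by simp
  then show ?thesis using InfWord v by auto
next
  case (BiinfWord f)
  with assms(1) obtain g where "v = BiinfWord g" by (cases v) auto
  then show ?thesis using assms(2) BiinfWord by auto
qed

lemma letters_eq_letter_at: "letters u = letter_at u ` positions u"
proof (cases u)
  case (FinWord xs)
  have "xs ! i \<in> (\<lambda>j. xs ! nat j) ` {0..<int (length xs)}" if "i < length xs" for i
    using that by (intro image_eqI[of _ _ "int i"]) auto
  then show ?thesis using FinWord by (force simp: set_conv_nth nat_less_iff)
next
  case (InfWord f)
  have "f i \<in> (\<lambda>j. f (nat j)) ` {0..}" for i
    by (rule image_eqI[of _ _ "int i"]) auto
  then show ?thesis using InfWord by auto
qed auto

section \<open>Blocks\<close>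

text \<open>Total in \<open>k\<close>: length and entries obey the same laws even where the block
  leaves the word, so only the claims about factors need position conditions.\<close>

definition block :: "nat \<Rightarrow> 'a word \<Rightarrow> int \<Rightarrow> 'a list" where
  "block N u k = subword u k (k + int N - 1)"

lemma length_block [simp]: "length (block N u k) = N"
  by (simp add: block_def subword_def)

lemma nth_block [simp]: "i < N \<Longrightarrow> block N u k ! i = letter_at u (k + int i)"
  by (simp add: block_def subword_def)

lemma take_block_Suc: "take N (block (N + 1) u k) = block N u k"
  by (rule nth_equalityI) auto

lemma tl_block_Suc: "tl (block (N + 1) u k) = block N u (k + 1)"
  by (rule nth_equalityI) (auto simp: nth_tl algebra_simps)

lemma factors_eq_blocks:
  "factors N X = {block N u k | u k. u \<in> X \<and> {k..k + int N - 1} \<subseteq> positions u}"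
  by (simp add: factors_def block_def)

text \<open>As \<open>N\<close> is positive, the interval is nonempty and its inclusion bounds both
  ends; an empty interval would be included for every \<open>k\<close>.\<close>

lemma positions_block_word:
  assumes "N \<ge> 1"
  shows "k \<in> positions (block_word N u) \<longleftrightarrow> {k..k + int N - 1} \<subseteq> positions u"
proof (cases u)
  case (FinWord xs)
  have "{k..k + int N - 1} \<subseteq> {0..<int (length xs)} \<longleftrightarrow> 0 \<le> k \<and> k + int N - 1 < int (length xs)"
    using assms by (auto simp: subset_iff)
  then show ?thesis using FinWord assms by auto
next
  case (InfWord f)
  then show ?thesis using assms by (auto simp: subset_iff)
qed auto

lemma letter_at_block_word:
  "k \<in> positions (block_word N u) \<Longrightarrow> letter_at (block_word N u) k = block N u k"
  by (cases u) (auto simp: block_def subword_def nat_less_iff)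

lemma positions_block_word_in:
  assumes "N \<ge> 1" "k \<in> positions (block_word N u)" "i < N"
  shows "k + int i \<in> positions u"
proof -
  have "k + int i \<in> {k..k + int N - 1}" using assms(3) by auto
  then show ?thesis using assms(1,2) positions_block_word by blast
qed

lemma shape_block_word_cong:
  "shape u = shape v \<Longrightarrow> shape (block_word N u) = shape (block_word N v)"
  by (cases u; cases v) (auto dest!: map_eq_imp_length_eq intro!: nth_equalityI)

text \<open>The length bounds matter: truncated subtraction sends all finite words shorter than
  \<open>N\<close> to the empty block word.\<close>

lemma shape_block_word_inject:
  assumes "shape (block_word N u) = shape (block_word N v)"
    and "word_length u \<ge> enat N" "word_length v \<ge> enat N"
  shows "shape u = shape v"
  using assms by (cases u; cases v) (auto dest!: map_eq_imp_length_eq intro!: nth_equalityI)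

text \<open>A word of length at least \<open>N\<close> has a nonempty block word. This supplies the
  length bound for words of a competing preimage, on which none is assumed.\<close>

lemma word_length_from_block_word:
  assumes "N \<ge> 1" "shape (block_word N u) = shape (block_word N v)" "word_length u \<ge> enat N"
  shows "word_length v \<ge> enat N"
  using assms by (cases u; cases v) (auto dest!: map_eq_imp_length_eq)

lemma position_in_block:
  assumes N: "N \<ge> 1" and len: "word_length u \<ge> enat N" and j: "j \<in> positions u"
  obtains i where "i < N" "j - int i \<in> positions (block_word N u)"
proof (cases u)
  case (FinWord xs)
  \<comment> \<open>The block starts at \<open>j\<close> itself unless it would overrun the word;
    then it is shifted left just enough to end at the last letter.\<close>
  let ?i = "nat (max 0 (j + int N - int (length xs)))"
  have "?i < N" "j - int ?i \<in> positions (block_word N u)"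
    using FinWord N len j by auto
  then show ?thesis by (rule that)
next
  case (InfWord f)
  then show ?thesis using that[of 0] N j by auto
next
  case (BiinfWord f)
  then show ?thesis using that[of 0] N by auto
qed

section \<open>The graph of a letter\<close>

text \<open>A vertex is traced back to an occurrence: the block at \<open>k\<close> in
  \<open>u\<close> with the absolute position \<open>k + int i\<close> marked.\<close>

lemma graph_verticesE:
  assumes "N \<ge> 1" "p \<in> graph_vertices X a N"
  obtains u k i where "u \<in> X" "k \<in> positions (block_word N u)" "i < N"
    "p = (i, block N u k)" "letter_at u (k + int i) = a"
proof -
  from assms(2) obtain i w where p: "p = (i, w)" "i < N" "w \<in> factors N X" "w ! i = a"
    by (auto simp: graph_vertices_def)
  then obtain u k where "u \<in> X" "{k..k + int N - 1} \<subseteq> positions u" "w = block N u k"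
    by (auto simp: factors_eq_blocks)
  then show ?thesis
    using p by (intro that[of u k i]) (auto simp: positions_block_word[OF assms(1)])
qed

lemma graph_verticesI:
  assumes "N \<ge> 1" "u \<in> X" "k \<in> positions (block_word N u)" "i < N"
  shows "(i, block N u k) \<in> graph_vertices X (letter_at u (k + int i)) N"
  using assms positions_block_word[OF assms(1)]
  by (fastforce simp: graph_vertices_def factors_eq_blocks)

lemma positions_block_word_Suc:
  assumes "N \<ge> 1"
  shows "{k..k + int (N + 1) - 1} \<subseteq> positions u \<longleftrightarrow>
    k \<in> positions (block_word N u) \<and> k + 1 \<in> positions (block_word N u)"
proof -
  have "{k..k + int (N + 1) - 1} = {k..k + int N - 1} \<union> {k + 1..k + 1 + int N - 1}"
    using assms by auto
  then show ?thesis by (simp only: positions_block_word[OF assms] Un_subset_iff)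
qed

lemma graph_edgesE:
  assumes "N \<ge> 1" "e \<in> graph_edges X a N"
  obtains u k i where "u \<in> X" "k \<in> positions (block_word N u)"
    "k + 1 \<in> positions (block_word N u)" "Suc i < N"
    "e = {(Suc i, block N u k), (i, block N u (k + 1))}"
proof -
  from assms(2) obtain i w where e: "e = {(i, take N w), (i - 1, tl w)}"
    "0 < i" "i < N" "w \<in> factors (N + 1) X"
    by (auto simp: graph_edges_def)
  then obtain u k where u: "u \<in> X" "{k..k + int (N + 1) - 1} \<subseteq> positions u"
    "w = block (N + 1) u k"
    by (auto simp: factors_eq_blocks)
  show ?thesis
    by (rule that[of u k "i - 1"])
      \<comment> \<open>The simplifier rewrites \<open>N + 1\<close>, so the facts are normalised in
        the same way to match.\<close>
      (use e u in \<open>auto simp: take_block_Suc[simplified] tl_block_Suc[simplified]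
        positions_block_word_Suc[OF assms(1), simplified]\<close>)
qed

lemma graph_edgesI:
  assumes "N \<ge> 1" "u \<in> X" "k \<in> positions (block_word N u)"
    "k + 1 \<in> positions (block_word N u)" "Suc i < N"
  shows "{(Suc i, block N u k), (i, block N u (k + 1))}
    \<in> graph_edges X (letter_at u (k + int (Suc i))) N"
proof -
  let ?w = "block (N + 1) u k"
  have "?w \<in> factors (N + 1) X"
    using assms positions_block_word_Suc[OF assms(1)] unfolding factors_eq_blocks by blast
  moreover have "?w ! Suc i = letter_at u (k + int (Suc i))"
    using assms(5) by (intro nth_block) simp
  ultimately show ?thesis
    using assms(5) unfolding graph_edges_def
    by (intro CollectI exI[of _ "Suc i"] exI[of _ ?w])
      (simp add: take_block_Suc[simplified] tl_block_Suc[simplified])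
qed

abbreviation graph_reach :: "'a word set \<Rightarrow> 'a \<Rightarrow> nat \<Rightarrow> ((nat \<times> 'a list) \<times> nat \<times> 'a list) set" where
  "graph_reach X a N \<equiv> {(p, q). {p, q} \<in> graph_edges X a N}\<^sup>*"

lemma sym_graph_reach: "sym (graph_reach X a N)"
  by (rule sym_rtrancl) (auto simp: sym_def insert_commute)

text \<open>Each edge slides the block one step right and lowers the index by one, which fixes the
  absolute position; \<open>d\<close> such edges form the path.\<close>

lemma graph_reach_same_position:
  assumes N: "N \<ge> 1" and u: "u \<in> X"
  shows "k \<in> positions (block_word N u) \<Longrightarrow> k + int d \<in> positions (block_word N u) \<Longrightarrow>
    i + d < N \<Longrightarrow>
    ((i + d, block N u k), (i, block N u (k + int d)))
      \<in> graph_reach X (letter_at u (k + int d + int i)) N"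
proof (induction d arbitrary: k)
  case (Suc d)
  \<comment> \<open>The positions of a block word form an interval, and \<open>k + 1\<close> lies
    between \<open>k\<close> and \<open>k + int (Suc d)\<close>.\<close>
  have k1: "k + 1 \<in> positions (block_word N u)"
    using Suc.prems N by (cases u) auto
  have "{(Suc (i + d), block N u k), (i + d, block N u (k + 1))}
      \<in> graph_edges X (letter_at u (k + int (Suc (i + d)))) N"
    using Suc.prems k1 N u by (intro graph_edgesI) auto
  moreover have "((i + d, block N u (k + 1)), (i, block N u (k + 1 + int d)))
      \<in> graph_reach X (letter_at u (k + 1 + int d + int i)) N"
    using Suc.prems k1 by (intro Suc.IH) (auto simp: algebra_simps)
  ultimately show ?case
    by (auto simp: algebra_simps intro: converse_rtrancl_into_rtrancl)
qed simp

section \<open>Connected letters imply maximality\<close>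

lemma connected_imp_projects_onto:
  assumes N: "N \<ge> 1" and len: "\<forall>u\<in>X. word_length u \<ge> enat N"
    and con: "\<And>a. [a] \<in> factors 1 X \<Longrightarrow> connected_letter N X a"
    and proj: "block_presentation N X \<succcurlyeq> block_presentation N Y"
  shows "X \<succcurlyeq> Y"
proof -
  from proj obtain \<psi> where \<psi>: "map_word \<psi> ` block_word N ` X = block_word N ` Y"
    by (auto simp: projects_onto_def block_presentation_def)
  define g where "g = (\<lambda>(i, w). \<psi> w ! i)"
  \<comment> \<open>On an occurrence, \<open>g\<close> reads the letter of the image word
    \<open>y\<close> at the marked absolute position. Both ends of an edge mark the same position,
    whence \<open>g_edge\<close>.\<close>
  have g_eq: "g (i, block N x k) = letter_at y (k + int i)"
    if "map_word \<psi> (block_word N x) = block_word N y" "k \<in> positions (block_word N x)" "i < N"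
    for x y k i
  proof -
    have "k \<in> positions (block_word N y)"
      using that(1,2) by (metis positions_map_word)
    then have "\<psi> (block N x k) = block N y k"
      using that(1,2) letter_at_map_word[OF that(2), of \<psi>] by (simp add: letter_at_block_word)
    then show ?thesis using that(3) by (simp add: g_def)
  qed
  have g_edge: "g p = g q" if "{p, q} \<in> graph_edges X a N" for p q a
    using N that
  proof (rule graph_edgesE)
    fix x k i
    assume x: "x \<in> X" "k \<in> positions (block_word N x)" "k + 1 \<in> positions (block_word N x)"
      "Suc i < N" and e: "{p, q} = {(Suc i, block N x k), (i, block N x (k + 1))}"
    from x(1) \<psi> obtain y where "map_word \<psi> (block_word N x) = block_word N y" by blast
    then have "g (Suc i, block N x k) = g (i, block N x (k + 1))"
      using x by (simp add: g_eq algebra_simps)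
    then show ?thesis using e by (auto simp: doubleton_eq_iff)
  qed
  have g_reach: "g p = g q" if "(p, q) \<in> graph_reach X a N" for p q a
    using that by (induction rule: rtrancl_induct) (auto dest: g_edge)
  \<comment> \<open>For a letter of \<open>X\<close>, connectedness makes the chosen vertex
    irrelevant; the value at other letters is arbitrary and never read.\<close>
  define \<phi> where "\<phi> a = g (SOME p. p \<in> graph_vertices X a N)" for a
  have \<phi>_eq: "map_word \<phi> x = y"
    if x: "x \<in> X" and y: "map_word \<psi> (block_word N x) = block_word N y" for x y
  proof (rule word_eqI)
    have lx: "word_length x \<ge> enat N" using x len by blast
    have sh: "shape (block_word N x) = shape (block_word N y)"
      using y by (metis shape_map_word)
    have "shape x = shape y"
      by (rule shape_block_word_inject[OF sh lx word_length_from_block_word[OF N sh lx]])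
    then show "shape (map_word \<phi> x) = shape y" by simp
    fix j assume "j \<in> positions (map_word \<phi> x)"
    then have j: "j \<in> positions x" by simp
    obtain i where i: "i < N" "j - int i \<in> positions (block_word N x)"
      using position_in_block[OF N _ j] x len by blast
    let ?a = "letter_at x j" and ?p = "(i, block N x (j - int i))"
    have p: "?p \<in> graph_vertices X ?a N"
      using graph_verticesI[OF N x i(2,1)] by simp
    have "[?a] = block 1 x j" by (simp add: block_def subword_def)
    then have "[?a] \<in> factors 1 X"
      using x j by (auto simp: factors_eq_blocks)
    then have "((SOME p. p \<in> graph_vertices X ?a N), ?p) \<in> graph_reach X ?a N"
      using con p someI[of "\<lambda>p. p \<in> graph_vertices X ?a N", OF p]
      by (auto simp: connected_letter_def graph_connected_def)
    then have "\<phi> ?a = g ?p"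
      unfolding \<phi>_def by (rule g_reach)
    also have "\<dots> = letter_at y j"
      using g_eq[OF y i(2,1)] by simp
    finally show "letter_at (map_word \<phi> x) j = letter_at y j"
      using j by simp
  qed
  have "map_word \<phi> ` X = Y"
  proof (intro equalityI subsetI)
    fix z assume "z \<in> map_word \<phi> ` X"
    then obtain x where x: "x \<in> X" "z = map_word \<phi> x" by blast
    with \<psi> obtain y where "y \<in> Y" "map_word \<psi> (block_word N x) = block_word N y" by blast
    then show "z \<in> Y" using x \<phi>_eq by blast
  next
    fix y assume "y \<in> Y"
    with \<psi> obtain x where "x \<in> X" "map_word \<psi> (block_word N x) = block_word N y"
      by (smt (verit) image_iff)
    then show "y \<in> map_word \<phi> ` X" using \<phi>_eq by blast
  qed
  then show ?thesis by (auto simp: projects_onto_def)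
qed

section \<open>Decorating letters with their components\<close>

text \<open>The second entry is the class of \<open>p\<close> under reachability in the graph of its
  marked letter. Keeping the letter as first entry lets \<open>fst\<close> undo the
  decoration.\<close>

definition component :: "nat \<Rightarrow> 'a word set \<Rightarrow> nat \<times> 'a list \<Rightarrow> 'a \<times> (nat \<times> 'a list) set" where
  "component N X p = (let a = snd p ! fst p in (a, graph_reach X a N `` {p}))"

text \<open>The choice of the block containing position \<open>j\<close> is immaterial, by
  \<open>letter_at_decorate\<close>.\<close>

definition decorate :: "nat \<Rightarrow> 'a word set \<Rightarrow> 'a word \<Rightarrow> ('a \<times> (nat \<times> 'a list) set) word" where
  "decorate N X u = relabel (\<lambda>j.
    let i = (SOME i. i < N \<and> j - int i \<in> positions (block_word N u))
    in component N X (i, block N u (j - int i))) u"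

lemma component_eq_iff:
  assumes "snd p ! fst p = a" "snd q ! fst q = a"
  shows "component N X p = component N X q \<longleftrightarrow> (p, q) \<in> graph_reach X a N"
proof -
  have "equiv UNIV (graph_reach X a N)"
    by (intro equivI sym_graph_reach refl_rtrancl trans_rtrancl) simp
  then show ?thesis
    using assms by (simp add: component_def Let_def eq_equiv_class_iff)
qed

text \<open>Of two blocks covering one position, the left one can be slid onto the right one inside
  the graph, so the decoration does not depend on the block.\<close>

lemma component_same_position:
  assumes N: "N \<ge> 1" and u: "u \<in> X"
    and k: "k \<in> positions (block_word N u)" "i < N"
    and k': "k' \<in> positions (block_word N u)" "i' < N"
    and eq: "k + int i = k' + int i'"
  shows "component N X (i, block N u k) = component N X (i', block N u k')"
proof -
  have *: "component N X (i, block N u k) = component N X (i', block N u k')"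
    if "k \<in> positions (block_word N u)" "i < N" "k' \<in> positions (block_word N u)" "i' < N"
      "k + int i = k' + int i'" "k \<le> k'" for k k' i i'
  proof -
    define d where "d = nat (k' - k)"
    have d: "k' = k + int d" "i = i' + d" using that by (auto simp: d_def)
    have "((i, block N u k), (i', block N u k')) \<in> graph_reach X (letter_at u (k' + int i')) N"
      using graph_reach_same_position[OF N u, of k d i'] that d by simp
    then show ?thesis
      using that by (subst component_eq_iff) auto
  qed
  show ?thesis
    using *[OF k k' eq] *[OF k' k eq[symmetric]] by (metis linear)
qed

lemma shape_decorate [simp]: "shape (decorate N X u) = shape u"
  by (simp add: decorate_def)

lemma letter_at_decorate:
  assumes N: "N \<ge> 1" and u: "u \<in> X"
    and k: "k \<in> positions (block_word N u)" "i < N"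
  shows "letter_at (decorate N X u) (k + int i) = component N X (i, block N u k)"
proof -
  let ?Q = "\<lambda>i'. i' < N \<and> k + int i - int i' \<in> positions (block_word N u)"
  have "?Q i" using k by simp
  then have "?Q (SOME i. ?Q i)" by (rule someI)
  moreover have "k + int i \<in> positions u"
    using positions_block_word_in[OF N k] .
  ultimately show ?thesis
    unfolding decorate_def using k
    by (auto simp: Let_def intro!: component_same_position[OF N u])
qed

text \<open>The length bound ensures that every position lies in some block, so the label there is a
  genuine component of the original letter.\<close>

lemma map_fst_decorate:
  assumes N: "N \<ge> 1" and u: "u \<in> X" and len: "word_length u \<ge> enat N"
  shows "map_word fst (decorate N X u) = u"
proof (rule word_eqI)
  show "shape (map_word fst (decorate N X u)) = shape u" by simp
  fix j assume "j \<in> positions (map_word fst (decorate N X u))"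
  then have j: "j \<in> positions (decorate N X u)" by simp
  then have ju: "j \<in> positions u"
    using positions_cong_shape[OF shape_decorate] by blast
  obtain i where i: "i < N" "j - int i \<in> positions (block_word N u)"
    using position_in_block[OF N len ju] .
  have "letter_at (decorate N X u) j = component N X (i, block N u (j - int i))"
    using letter_at_decorate[OF N u i(2,1)] by simp
  then show "letter_at (map_word fst (decorate N X u)) j = letter_at u j"
    using j i by (simp add: component_def Let_def)
qed

text \<open>The labels along a block depend only on its content \<open>w\<close> and the index, not
  on where it occurs; hence a letter map on blocks produces them.\<close>

lemma block_word_decorate:
  assumes N: "N \<ge> 1" and u: "u \<in> X"
  shows "map_word (\<lambda>w. map (\<lambda>i. component N X (i, w)) [0..<N]) (block_word N u)
    = block_word N (decorate N X u)" (is "map_word ?h _ = _")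
proof (rule word_eqI)
  have sh: "shape (block_word N u) = shape (block_word N (decorate N X u))"
    by (rule shape_block_word_cong) simp
  then show "shape (map_word ?h (block_word N u)) = shape (block_word N (decorate N X u))"
    by simp
  fix k assume "k \<in> positions (map_word ?h (block_word N u))"
  then have k: "k \<in> positions (block_word N u)" by simp
  then have k': "k \<in> positions (block_word N (decorate N X u))"
    using positions_cong_shape[OF sh] by simp
  have "?h (block N u k) = block N (decorate N X u) k"
    by (rule nth_equalityI) (use k in \<open>auto simp: letter_at_decorate[OF N u]\<close>)
  then show "letter_at (map_word ?h (block_word N u)) k
      = letter_at (block_word N (decorate N X u)) k"
    using k k' by (simp add: letter_at_block_word)
qed

section \<open>The decorated word set as an \<open>N\<close>-preimage\<close>

lemma finite_factors:
  assumes "word_set X"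
  shows "finite (factors N X)"
proof (rule finite_subset)
  let ?A = "\<Union>u\<in>X. letters u"
  show "factors N X \<subseteq> {w. set w \<subseteq> ?A \<and> length w = N}"
    by (auto simp: factors_eq_blocks in_set_conv_nth letters_eq_letter_at subset_iff
        intro!: bexI imageI)
  show "finite {w. set w \<subseteq> ?A \<and> length w = N}"
    using assms by (intro finite_lists_length_eq) (simp add: word_set_def)
qed

lemma letters_decorate_subset:
  assumes N: "N \<ge> 1" and u: "u \<in> X" and len: "word_length u \<ge> enat N"
  shows "letters (decorate N X u) \<subseteq> component N X ` ({..<N} \<times> factors N X)"
proof
  fix c assume "c \<in> letters (decorate N X u)"
  then obtain j where j: "j \<in> positions u" "c = letter_at (decorate N X u) j"
    using positions_cong_shape[OF shape_decorate, of N X u] by (auto simp: letters_eq_letter_at)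
  obtain i where i: "i < N" "j - int i \<in> positions (block_word N u)"
    using position_in_block[OF N len j(1)] .
  then have "c = component N X (i, block N u (j - int i))"
    using letter_at_decorate[OF N u i(2,1)] j by simp
  moreover have "block N u (j - int i) \<in> factors N X"
    using graph_verticesI[OF N u i(2,1)] by (simp add: graph_vertices_def)
  ultimately show "c \<in> component N X ` ({..<N} \<times> factors N X)"
    using i by blast
qed

lemma preimage_decorate:
  assumes N: "N \<ge> 1" and X: "word_set X" and len: "\<forall>u\<in>X. word_length u \<ge> enat N"
  shows "preimage N (decorate N X ` X) (block_presentation N X)"
proof -
  let ?Y = "decorate N X ` X"
  have fst: "map_word fst ` ?Y = X"
    using map_fst_decorate[OF N] len by (force simp: image_image)
  have "(\<Union>u\<in>?Y. letters u) \<subseteq> component N X ` ({..<N} \<times> factors N X)"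
    using letters_decorate_subset[OF N] len by blast
  then have "word_set ?Y"
    unfolding word_set_def by (rule finite_subset) (simp add: finite_factors[OF X])
  moreover have "block_presentation N ?Y \<succcurlyeq> block_presentation N X"
    using block_presentation_map_word[OF N, of fst ?Y] fst unfolding projects_onto_def by metis
  moreover have "block_presentation N X \<succcurlyeq> block_presentation N ?Y"
    unfolding projects_onto_def block_presentation_def
    by (rule exI[of _ "\<lambda>w. map (\<lambda>i. component N X (i, w)) [0..<N]"])
      (simp add: image_image block_word_decorate[OF N] cong: image_cong)
  ultimately show ?thesis
    by (simp add: preimage_def similar_def)
qed

section \<open>Maximality implies connected letters\<close>

lemma maximal_imp_connected:
  assumes N: "N \<ge> 1" and X: "word_set X" and len: "\<forall>u\<in>X. word_length u \<ge> enat N"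
    and max: "maximal_preimage N X (block_presentation N X)"
  shows "connected_letter N X a"
proof -
  let ?Y = "decorate N X ` X"
  let ?A = "\<Union>u\<in>X. letters u" and ?B = "\<Union>u\<in>?Y. letters u"
  have "X \<succcurlyeq> ?Y"
    \<comment> \<open>Decorated letters are not naturals, so maximality is applied in its form for
      arbitrary alphabets.\<close>
    by (rule maximal_preimage_any_alphabet[OF N max preimage_decorate[OF N X len]])
  then obtain \<phi> where \<phi>: "map_word \<phi> ` X = ?Y" by (auto simp: projects_onto_def)
  have fst: "map_word fst ` ?Y = X"
    using map_fst_decorate[OF N] len by (force simp: image_image)
  have "(\<Union>u\<in>map_word \<phi> ` X. letters u) = \<phi> ` ?A"
    by (auto simp: word.set_map)
  then have B: "?B = \<phi> ` ?A" by (simp only: \<phi>)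
  have "(\<Union>u\<in>map_word fst ` ?Y. letters u) = fst ` ?B"
    by (auto simp: word.set_map)
  then have A: "?A = fst ` ?B" by (simp only: fst)
  have fin: "finite ?A" using X by (simp add: word_set_def)
  then have "finite ?B" by (simp only: B finite_imageI)
  \<comment> \<open>\<open>fst\<close> maps \<open>?B\<close> onto \<open>?A\<close> and
    \<open>\<phi>\<close> maps \<open>?A\<close> onto \<open>?B\<close>; being finite, they have
    equal cardinality, which makes \<open>fst\<close> injective on \<open>?B\<close>.\<close>
  moreover have "card (fst ` ?B) = card ?B"
  proof (rule antisym)
    show "card (fst ` ?B) \<le> card ?B" by (rule card_image_le) fact
    have "card ?B \<le> card ?A" unfolding B using fin by (rule card_image_le)
    then show "card ?B \<le> card (fst ` ?B)" by (simp only: A)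
  qed
  ultimately have inj: "inj_on fst ?B" by (rule eq_card_imp_inj_on)
  have vert: "component N X p \<in> ?B \<and> snd p ! fst p = a" if "p \<in> graph_vertices X a N" for p
    using N that
  proof (rule graph_verticesE)
    fix u k i
    assume u: "u \<in> X" "k \<in> positions (block_word N u)" "i < N" "p = (i, block N u k)"
      "letter_at u (k + int i) = a"
    have "k + int i \<in> positions (decorate N X u)"
      using positions_block_word_in[OF N u(2,3)] positions_cong_shape[OF shape_decorate] by blast
    then have "component N X p \<in> letters (decorate N X u)"
      using letter_at_decorate[OF N u(1-3)] u(4) unfolding letters_eq_letter_at by (metis imageI)
    then show ?thesis using u by auto
  qed
  show ?thesis
    unfolding connected_letter_def graph_connected_def
  proof (intro ballI)
    fix p q assume "p \<in> graph_vertices X a N" "q \<in> graph_vertices X a N"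
    note pq = vert[OF this(1)] vert[OF this(2)]
    \<comment> \<open>Both components carry the letter \<open>a\<close>, so injectivity of
      \<open>fst\<close> merges them.\<close>
    then have "fst (component N X p) = fst (component N X q)"
      by (simp add: component_def Let_def)
    then have "component N X p = component N X q"
      using inj_onD[OF inj] pq by blast
    then show "(p, q) \<in> graph_reach X a N"
      using pq by (subst component_eq_iff[symmetric]) auto
  qed
qed

theorem theorem2:
  fixes N :: nat and X :: "'a word set"
  assumes "N \<ge> 1"
    and "word_set X"
    and "\<forall>u\<in>X. word_length u \<ge> enat N"
  shows "maximal_preimage N X (block_presentation N X) \<longleftrightarrow>
    (\<forall>a. [a] \<in> factors 1 X \<longrightarrow> connected_letter N X a)"
proof
  assume "maximal_preimage N X (block_presentation N X)"
  then show "\<forall>a. [a] \<in> factors 1 X \<longrightarrow> connected_letter N X a"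
    using maximal_imp_connected[OF assms] by blast
next
  assume con: "\<forall>a. [a] \<in> factors 1 X \<longrightarrow> connected_letter N X a"
  have "map_word id ` block_presentation N X = block_presentation N X"
    by (simp add: word.map_id)
  then have "preimage N X (block_presentation N X)"
    using assms(2) by (auto simp: preimage_def similar_def projects_onto_def)
  moreover have "X \<succcurlyeq> Y" if "preimage N Y (block_presentation N X)" for Y :: "nat word set"
    using connected_imp_projects_onto[OF assms(1,3)] con that
    by (auto simp: preimage_def similar_def)
  ultimately show "maximal_preimage N X (block_presentation N X)"
    by (simp add: maximal_preimage_def)
qed

end
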